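(* Let $\mathcal{P}=(\{\mathcal{E}_k:k\in K\},\{M_0,M_1\})$ be a concurrent quantum program on a Hilbert space $\mathcal{H}$ of finite dimension $d$, and let $\rho_0$ be an initial density operator. Then $$\mathcal{H}_{URR}=\operatorname{supp}\Big(\sum_{i=d}^{2d-1}\mathcal{F}^i(\rho_0)\Big),\qquad \mathcal{F}=\sum_{k\in K}\mathcal{F}_k.$$
   Context: $\mathcal{H}$ is a complex Hilbert space of finite dimension $d\ge 1$. A super-operator on $\mathcal{H}$ is a completely positive linear map on operators on $\mathcal{H}$ that does not increase trace of positive operators; trace-preserving if it preserves trace. $\operatorname{supp}(\rho)$ for positive semidefinite $\rho$ is the span of eigenvectors with nonzero eigenvalues. A concurrent quantum program is a pair $\mathcal{P}=(\{\mathcal{E}_k:k\in K\},\{M_0,M_1\})$ with $K=\{1,\dots,m\}$, each $\mathcal{E}_k$ a trace-preserving super-operator on $\mathcal{H}$, and $M_0^\dagger M_0+M_1^\dagger M_1=I$. Define $\mathcal{F}_k(\rho)=\mathcal{E}_k(M_1\rho M_1^\dagger)$; for a finite string $f=s_1\cdots s_n$ over $K$ (length $|f|=n$), $\mathcal{F}_f=\mathcal{F}_{s_n}\circ\cdots\circ\mathcal{F}_{s_1}$. $\mathcal{F}^i$ is the $i$-fold composition. The uniformly repeatedly reachable space is $\mathcal{H}_{URR}=\bigcap_{n\ge0}\bigvee\{\operatorname{supp}\mathcal{F}_f(\rho_0): f\in K^*,\ |f|\ge n\}$, where $\bigvee$ is the span of the union of subspaces. *)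

theory Defs
  imports "HOL-Analysis.Analysis"
begin

text \<open>Operators on the d-dimensional Hilbert space H = complex^'n (d = CARD('n))
  are represented as complex d x d matrices of type complex^'n^'n.\<close>

type_synonym 'n qop = "complex^'n^'n"

definition adj :: "'n::finite qop \<Rightarrow> 'n qop" where
  "adj A = (\<chi> i j. cnj (A $ j $ i))"

definition smul_op :: "complex \<Rightarrow> 'n::finite qop \<Rightarrow> 'n qop" where
  "smul_op c A = (\<chi> i j. c * A $ i $ j)"

definition trace_op :: "'n::finite qop \<Rightarrow> complex" where
  "trace_op A = (\<Sum>i\<in>UNIV. A $ i $ i)"

text \<open>Sesquilinear form  <u, A v>.\<close>
definition sesq :: "complex^'n \<Rightarrow> 'n::finite qop \<Rightarrow> complex^'n \<Rightarrow> complex" where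
  "sesq u A v = (\<Sum>i\<in>UNIV. \<Sum>j\<in>UNIV. cnj (u $ i) * A $ i $ j * v $ j)"

text \<open>Positive semidefinite operator: <v, A v> is real and nonnegative for all v.\<close>
definition psd :: "'n::finite qop \<Rightarrow> bool" where
  "psd A \<longleftrightarrow> (\<forall>v. Im (sesq v A v) = 0 \<and> Re (sesq v A v) \<ge> 0)"

text \<open>Positivity of an m x m block operator with blocks X i j (i,j<m), i.e. an operator
  on C^m \<otimes> H.\<close>
definition block_psd :: "nat \<Rightarrow> (nat \<Rightarrow> nat \<Rightarrow> 'n::finite qop) \<Rightarrow> bool" where
  "block_psd m X \<longleftrightarrow>
     (\<forall>v :: nat \<Rightarrow> complex^'n.
        Im (\<Sum>i<m. \<Sum>j<m. sesq (v i) (X i j) (v j)) = 0 \<and>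
        Re (\<Sum>i<m. \<Sum>j<m. sesq (v i) (X i j) (v j)) \<ge> 0)"

definition clinear_op :: "('n::finite qop \<Rightarrow> 'n qop) \<Rightarrow> bool" where
  "clinear_op \<Phi> \<longleftrightarrow> (\<forall>A B. \<Phi> (A + B) = \<Phi> A + \<Phi> B) \<and> (\<forall>c A. \<Phi> (smul_op c A) = smul_op c (\<Phi> A))"

text \<open>Complete positivity: id_m \<otimes> \<Phi> is positive for every ancilla dimension m.\<close>
definition completely_positive :: "('n::finite qop \<Rightarrow> 'n qop) \<Rightarrow> bool" where
  "completely_positive \<Phi> \<longleftrightarrow>
     (\<forall>m X. block_psd m X \<longrightarrow> block_psd m (\<lambda>i j. \<Phi> (X i j)))"

definition super_operator :: "('n::finite qop \<Rightarrow> 'n qop) \<Rightarrow> bool" where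
  "super_operator \<Phi> \<longleftrightarrow> clinear_op \<Phi> \<and> completely_positive \<Phi> \<and>
     (\<forall>A. psd A \<longrightarrow> Re (trace_op (\<Phi> A)) \<le> Re (trace_op A))"

definition trace_preserving :: "('n::finite qop \<Rightarrow> 'n qop) \<Rightarrow> bool" where
  "trace_preserving \<Phi> \<longleftrightarrow> (\<forall>A. trace_op (\<Phi> A) = trace_op A)"

definition density_op :: "'n::finite qop \<Rightarrow> bool" where
  "density_op \<rho> \<longleftrightarrow> psd \<rho> \<and> trace_op \<rho> = 1"

text \<open>Support: span of the eigenvectors with nonzero eigenvalues.\<close>
definition supp :: "'n::finite qop \<Rightarrow> (complex^'n) set" where
  "supp A = span {v. \<exists>c. c \<noteq> 0 \<and> A *v v = c *s v}"

text \<open>Concurrent quantum program with K = {1..m}: E k for k in K, measurement {M0, M1}.\<close>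
definition concurrent_program ::
  "nat \<Rightarrow> (nat \<Rightarrow> 'n::finite qop \<Rightarrow> 'n qop) \<Rightarrow> 'n qop \<Rightarrow> 'n qop \<Rightarrow> bool" where
  "concurrent_program m E M0 M1 \<longleftrightarrow>
     (\<forall>k\<in>{1..m}. super_operator (E k) \<and> trace_preserving (E k)) \<and>
     adj M0 ** M0 + adj M1 ** M1 = mat 1"

definition Fk :: "(nat \<Rightarrow> 'n::finite qop \<Rightarrow> 'n qop) \<Rightarrow> 'n qop \<Rightarrow> nat \<Rightarrow> 'n qop \<Rightarrow> 'n qop" where
  "Fk E M1 k \<rho> = E k (M1 ** \<rho> ** adj M1)"

text \<open>F_f = F_{s_n} o ... o F_{s_1} for f = s_1 ... s_n.\<close>
definition Fstr :: "(nat \<Rightarrow> 'n::finite qop \<Rightarrow> 'n qop) \<Rightarrow> 'n qop \<Rightarrow> nat list \<Rightarrow> 'n qop \<Rightarrow> 'n qop" where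
  "Fstr E M1 f = fold (Fk E M1) f"

definition Fsum :: "nat \<Rightarrow> (nat \<Rightarrow> 'n::finite qop \<Rightarrow> 'n qop) \<Rightarrow> 'n qop \<Rightarrow> 'n qop \<Rightarrow> 'n qop" where
  "Fsum m E M1 \<rho> = (\<Sum>k\<in>{1..m}. Fk E M1 k \<rho>)"

definition H_URR :: "nat \<Rightarrow> (nat \<Rightarrow> 'n::finite qop \<Rightarrow> 'n qop) \<Rightarrow> 'n qop \<Rightarrow> 'n qop \<Rightarrow> (complex^'n) set" where
  "H_URR m E M1 \<rho>0 =
     (\<Inter>n. span (\<Union>{supp (Fstr E M1 f \<rho>0) | f. set f \<subseteq> {1..m} \<and> length f \<ge> n}))"

end

theory Submission
  imports Defs "HOL-Computational_Algebra.Fundamental_Theorem_Algebra"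
begin

text \<open>
  Write \<open>\<rho> i = \<F>\<^sup>i \<rho>\<^sub>0\<close> and \<open>S i = supp (\<rho> i)\<close>. The proof has three ingredients.

  \<^item> \<open>\<F>\<^sup>i\<close> is the sum of the \<open>\<F>\<^sub>f\<close> over the strings \<open>f\<close> of length \<open>i\<close>, and the support of a
    finite sum of positive operators is the span of the supports. So \<open>S i\<close> is spanned by
    the supports reached along strings of length \<open>i\<close>, and the \<open>n\<close>-th space in the
    definition of \<open>H_URR\<close> is the tail span \<open>V n = span (\<Union>i\<ge>n. S i)\<close>.
  \<^item> For a positive operator the support is the orthogonal complement of the kernel (an
    eigenvector argument based on the fundamental theorem of algebra). Hence positive maps
    preserve inclusion of supports, and for \<open>\<F>\<close> an inclusion \<open>S j \<subseteq> span (\<Union>i\<in>I. S i)\<close>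
    implies \<open>S (j + 1) \<subseteq> span (\<Union>i\<in>I. S (i + 1))\<close>.
  \<^item> For any sequence of complex subspaces of \<open>\<complex>\<^sup>d\<close> with this shift property, \<open>d\<close>
    consecutive terms already span every tail, and the decreasing chain \<open>V n\<close> is constant
    from \<open>n = d\<close> on, since each strict inclusion of complex subspaces changes the real
    dimension by at least two. Hence \<open>\<Inter>n. V n = V d = span (S d \<union> \<dots> \<union> S (2d - 1))\<close>,
    the support of \<open>\<rho> d + \<dots> + \<rho> (2d - 1)\<close>.
\<close>

section \<open>The complex inner product on \<open>complex^'n\<close>\<close>

text \<open>The Euclidean inner product of \<open>complex^'n\<close> (viewed as a real space) is the real part of
  the Hermitian inner product \<open>ip\<close>; complex orthogonality is needed to work with complex
  subspaces.\<close>

definition ip :: "complex^'n::finite \<Rightarrow> complex^'n \<Rightarrow> complex" where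
  "ip u v = (\<Sum>i\<in>UNIV. cnj (u $ i) * v $ i)"

lemma sesq_ip: "sesq u A v = ip u (A *v v)"
  unfolding sesq_def ip_def matrix_vector_mult_def
  by (simp add: sum_distrib_left mult.assoc)

lemma ip_add_left: "ip (u + w) v = ip u v + ip w v"
  unfolding ip_def by (simp add: distrib_right sum.distrib)

lemma ip_add_right: "ip u (v + w) = ip u v + ip u w"
  unfolding ip_def by (simp add: distrib_left sum.distrib)

lemma ip_smult_left: "ip (c *s u) v = cnj c * ip u v"
  unfolding ip_def by (simp add: sum_distrib_left mult.assoc)

lemma ip_smult_right: "ip u (c *s v) = c * ip u v"
  unfolding ip_def by (simp add: sum_distrib_left mult.left_commute)

lemma ip_zero_left [simp]: "ip 0 v = 0"
  unfolding ip_def by simp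

lemma ip_zero_right [simp]: "ip u 0 = 0"
  unfolding ip_def by simp

lemma ip_cnj: "cnj (ip u v) = ip v u"
  unfolding ip_def by (simp add: mult.commute)

lemma inner_ip: "inner u (v::complex^'n::finite) = Re (ip u v)"
  unfolding ip_def inner_vec_def inner_complex_def by (simp add: Re_sum)

lemma ip_self_eq_0_iff: "ip v v = 0 \<longleftrightarrow> v = 0"
proof -
  have "Im (ip v v) = 0" unfolding ip_def by (simp add: Im_sum)
  then have "ip v v = of_real (inner v v)" by (simp add: inner_ip complex_eq_iff)
  then show ?thesis by simp
qed

lemma scaleR_smult: "r *\<^sub>R (u::complex^'n::finite) = of_real r *s u"
  unfolding vec_eq_iff vector_scaleR_component vector_smult_component
  by (simp add: scaleR_conv_of_real)

lemma matrix_vector_smult: "A *v (c *s v) = c *s (A *v (v::complex^'n::finite))"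
  by (simp add: matrix_vector_mult_def vec_eq_iff sum_distrib_left mult.left_commute)

lemma ip_adj: "ip u (M *v x) = ip (adj M *v u) x"
proof -
  have "ip u (M *v x) = (\<Sum>i\<in>UNIV. \<Sum>j\<in>UNIV. cnj (u $ i) * M $ i $ j * x $ j)"
    unfolding ip_def matrix_vector_mult_def by (simp add: sum_distrib_left mult.assoc)
  also have "\<dots> = (\<Sum>j\<in>UNIV. \<Sum>i\<in>UNIV. cnj (u $ i) * M $ i $ j * x $ j)"
    by (rule sum.swap)
  also have "\<dots> = ip (adj M *v u) x"
    unfolding ip_def matrix_vector_mult_def adj_def
    by (simp add: sum_distrib_right sum_distrib_left mult_ac)
  finally show ?thesis .
qed

lemma sesq_add_left: "sesq (u + w) A v = sesq u A v + sesq w A v"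
  by (simp add: sesq_ip ip_add_left)

lemma sesq_add_right: "sesq u A (v + w) = sesq u A v + sesq u A w"
  by (simp add: sesq_ip ip_add_right matrix_vector_right_distrib)

lemma sesq_smult_left: "sesq (c *s u) A v = cnj c * sesq u A v"
  by (simp add: sesq_ip ip_smult_left)

lemma sesq_smult_right: "sesq u A (c *s v) = c * sesq u A v"
  by (simp add: sesq_ip ip_smult_right matrix_vector_smult)

lemma sesq_add_op: "sesq v (A + B) v = sesq v A v + sesq v B v"
  by (simp add: sesq_ip matrix_vector_mult_add_rdistrib ip_add_right)

lemma sesq_diff_op: "sesq v (A - B) v = sesq v A v - sesq v B v"
  by (simp add: sesq_ip matrix_vector_mult_diff_rdistrib ip_def sum_subtractf right_diff_distrib)

lemma sesq_smul_op: "sesq v (smul_op c A) v = c * sesq v A v"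
proof -
  have "smul_op c A *v v = c *s (A *v v)"
    unfolding smul_op_def
    by (simp add: matrix_vector_mult_def vec_eq_iff sum_distrib_left mult.assoc)
  then show ?thesis by (simp add: sesq_ip ip_smult_right)
qed

section \<open>Positive semidefinite operators\<close>

text \<open>Polarization: a form with real diagonal is Hermitian.\<close>
lemma psd_hermitian:
  assumes "psd A"
  shows "sesq v A u = cnj (sesq u A v)"
proof -
  have im: "\<And>x. Im (sesq x A x) = 0" using assms unfolding psd_def by auto
  have e1: "sesq (u + v) A (u + v) = sesq u A u + sesq u A v + sesq v A u + sesq v A v"
    by (simp add: sesq_add_left sesq_add_right)
  have e2: "sesq (\<i> *s u + v) A (\<i> *s u + v)
            = sesq u A u - \<i> * sesq u A v + \<i> * sesq v A u + sesq v A v"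
    by (simp add: sesq_add_left sesq_add_right sesq_smult_left sesq_smult_right
        ring_distribs mult.assoc[symmetric])
  have "Im (sesq u A v + sesq v A u) = 0"
    using im[of "u + v"] im[of u] im[of v] e1 by simp
  moreover have "Re (sesq v A u) = Re (sesq u A v)"
    using im[of "\<i> *s u + v"] im[of u] im[of v] e2 by simp
  ultimately show ?thesis by (simp add: complex_eq_iff)
qed

lemma psd_self_adjoint: "psd A \<Longrightarrow> ip u (A *v v) = ip (A *v u) v"
  using psd_hermitian[of A u v] by (simp add: sesq_ip ip_cnj)

lemma psd_quad: "psd A \<Longrightarrow> sesq v A v = of_real (Re (sesq v A v)) \<and> 0 \<le> Re (sesq v A v)"
  unfolding psd_def by (simp add: complex_eq_iff)

text \<open>A real quadratic \<open>2ta + t\<^sup>2b\<close> that is nonnegative for all \<open>t\<close> has no linear term.\<close>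
lemma nonneg_quadratic_linear_coeff:
  fixes a b :: real
  assumes "\<And>t. 0 \<le> 2 * t * a + t\<^sup>2 * b"
  shows "a = 0"
proof (rule ccontr)
  assume "a \<noteq> 0"
  have "0 \<le> b" using assms[of 1] assms[of "-1"] by simp
  define c where "c = 1 / (b + 1)"
  have "0 < c" "c * b < 1" unfolding c_def using \<open>0 \<le> b\<close> by (simp_all add: field_simps)
  then have "a\<^sup>2 * c * (c * b - 2) < 0" using \<open>a \<noteq> 0\<close> by (intro mult_pos_neg) auto
  moreover have "2 * (-a * c) * a + (-a * c)\<^sup>2 * b = a\<^sup>2 * c * (c * b - 2)"
    by (simp add: power2_eq_square algebra_simps)
  ultimately show False using assms[of "-a * c"] by simp
qed

text \<open>For a positive operator, a vanishing quadratic form forces the vector into the kernel.\<close>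
lemma psd_quad_zero_imp_kernel:
  assumes "psd A" "sesq v A v = 0"
  shows "A *v v = 0"
proof -
  have re0: "Re (sesq w A v) = 0" for w
  proof -
    have "sesq (v + of_real r *s w) A (v + of_real r *s w)
          = of_real r * (sesq v A w + sesq w A v) + of_real r * of_real r * sesq w A w" for r
      using assms(2) by (simp add: sesq_add_left sesq_add_right sesq_smult_left sesq_smult_right
          ring_distribs mult.assoc)
    moreover have "Re (sesq v A w + sesq w A v) = 2 * Re (sesq w A v)"
      using psd_hermitian[OF assms(1), of w v] by simp
    ultimately have "0 \<le> 2 * r * Re (sesq w A v) + r\<^sup>2 * Re (sesq w A w)" for r
      using psd_quad[OF assms(1), of "v + of_real r *s w"] by (simp add: power2_eq_square)
    then show ?thesis by (rule nonneg_quadratic_linear_coeff)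
  qed
  have "sesq (A *v v) A v = 0"
    using re0[of "A *v v"] re0[of "\<i> *s (A *v v)"] by (simp add: sesq_smult_left complex_eq_iff)
  then show ?thesis by (simp add: sesq_ip ip_self_eq_0_iff)
qed

lemma psd_add: "psd A \<Longrightarrow> psd B \<Longrightarrow> psd (A + B)"
  unfolding psd_def by (simp add: sesq_add_op)

lemma psd_sum: "(\<And>i. i \<in> I \<Longrightarrow> psd (X i)) \<Longrightarrow> psd (\<Sum>i\<in>I. X i)"
proof (induct I rule: infinite_finite_induct)
  case (insert x F)
  then show ?case by (simp add: psd_add)
qed (simp_all add: psd_def sesq_ip ip_def)

section \<open>Complex subspaces and invariant subspaces\<close>

text \<open>Subspaces in the library are real; a complex subspace is additionally closed under
  multiplication by complex scalars.\<close>

definition complex_subspace :: "(complex^'n::finite) set \<Rightarrow> bool" where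
  "complex_subspace U \<longleftrightarrow> subspace U \<and> (\<forall>c v. v \<in> U \<longrightarrow> c *s v \<in> U)"

definition invariant :: "'n::finite qop \<Rightarrow> (complex^'n) set \<Rightarrow> bool" where
  "invariant A U \<longleftrightarrow> (\<forall>x\<in>U. A *v x \<in> U)"

lemma complex_subspace_span:
  assumes "\<And>c v. v \<in> S \<Longrightarrow> c *s v \<in> S"
  shows "complex_subspace (span (S::(complex^'n::finite) set))"
  unfolding complex_subspace_def
proof (intro conjI allI impI)
  fix c v assume "v \<in> span S"
  moreover have "span S \<subseteq> {v. c *s v \<in> span S}"
  proof (rule span_minimal)
    show "subspace {v. c *s v \<in> span S}"
    proof (rule subspaceI)
      fix x y assume "x \<in> {v. c *s v \<in> span S}" "y \<in> {v. c *s v \<in> span S}"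
      then show "x + y \<in> {v. c *s v \<in> span S}" by (simp add: vector_add_ldistrib span_add)
    next
      fix r :: real and x assume "x \<in> {v. c *s v \<in> span S}"
      moreover have "c *s (r *\<^sub>R x) = r *\<^sub>R (c *s x)"
        by (simp add: scaleR_smult vector_smult_assoc mult.commute)
      ultimately show "r *\<^sub>R x \<in> {v. c *s v \<in> span S}" by (simp add: span_scale)
    qed (simp add: span_zero)
  qed (use assms span_base in blast)
  ultimately show "c *s v \<in> span S" by blast
qed simp

lemma complex_subspace_Int:
  "complex_subspace U \<Longrightarrow> complex_subspace W \<Longrightarrow> complex_subspace (U \<inter> W)"
  unfolding complex_subspace_def using subspace_inter by blast

text \<open>Real orthogonality to a complex subspace is complex orthogonality.\<close>
lemma complex_subspace_perp_ip:
  assumes "complex_subspace U" "u \<in> U" "x \<in> U\<^sup>\<bottom>"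
  shows "ip u x = 0"
proof -
  have "\<i> *s u \<in> U" using assms(1,2) unfolding complex_subspace_def by blast
  then have "inner u x = 0" "inner (\<i> *s u) x = 0"
    using assms(2,3) unfolding orthogonal_comp_def orthogonal_def by blast+
  then have "Re (ip u x) = 0" "Re (ip (\<i> *s u) x) = 0" by (simp_all only: inner_ip)
  then show ?thesis by (simp add: ip_smult_left complex_eq_iff)
qed

lemma complex_subspace_perp:
  assumes "complex_subspace U"
  shows "complex_subspace (U\<^sup>\<bottom>)"
  unfolding complex_subspace_def
proof (intro conjI allI impI)
  fix c x assume x: "x \<in> U\<^sup>\<bottom>"
  have "inner u (c *s x) = 0" if "u \<in> U" for u
    using complex_subspace_perp_ip[OF assms that x] by (simp add: inner_ip ip_smult_right)
  then show "c *s x \<in> U\<^sup>\<bottom>" unfolding orthogonal_comp_def orthogonal_def by blast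
qed (rule subspace_orthogonal_comp)

text \<open>The orthogonal complement of an invariant complex subspace of a positive operator is
  again invariant.\<close>
lemma invariant_perp:
  assumes "psd A" "complex_subspace U" "invariant A U"
  shows "invariant A (U\<^sup>\<bottom>)"
  unfolding invariant_def
proof
  fix x assume x: "x \<in> U\<^sup>\<bottom>"
  have "inner u (A *v x) = 0" if "u \<in> U" for u
  proof -
    have "A *v u \<in> U" using assms(3) that unfolding invariant_def by blast
    then have "ip (A *v u) x = 0" using complex_subspace_perp_ip[OF assms(2) _ x] by blast
    then show ?thesis by (simp add: inner_ip psd_self_adjoint[OF assms(1)])
  qed
  then show "A *v x \<in> U\<^sup>\<bottom>" unfolding orthogonal_comp_def orthogonal_def by blast
qed

section \<open>Eigenvectors in invariant subspaces\<close>

text \<open>The vector \<open>p(A) w\<close> for a complex polynomial \<open>p\<close>.\<close>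
definition poly_apply :: "'n::finite qop \<Rightarrow> complex poly \<Rightarrow> complex^'n \<Rightarrow> complex^'n" where
  "poly_apply A p w = (\<Sum>i\<le>degree p. coeff p i *s ((*v) A ^^ i) w)"

lemma poly_apply_upto:
  assumes "degree p \<le> N"
  shows "poly_apply A p w = (\<Sum>i\<le>N. coeff p i *s ((*v) A ^^ i) w)"
  unfolding poly_apply_def
  by (rule sum.mono_neutral_left) (use assms in \<open>auto simp: coeff_eq_0\<close>)

lemma matrix_vector_sum: "A *v (\<Sum>i\<in>I. f i) = (\<Sum>i\<in>I. A *v f i)"
  by (induct I rule: infinite_finite_induct) (auto simp: matrix_vector_right_distrib)

lemma smult_sum: "c *s (\<Sum>i\<in>I. f i) = (\<Sum>i\<in>I. c *s (f i :: complex^'n::finite))"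
  by (induct I rule: infinite_finite_induct) (auto simp: vector_add_ldistrib)

text \<open>Splitting off a linear factor: \<open>((A - l) q(A)) w\<close>.\<close>
lemma poly_apply_linear_factor:
  "poly_apply A ([:-l, 1:] * q) w = A *v poly_apply A q w - l *s poly_apply A q w"
proof -
  define N where "N = Suc (degree q)"
  have deg: "degree ([:-l, 1:] * q) \<le> N"
    unfolding N_def by (rule order.trans[OF degree_mult_le]) simp
  have "poly_apply A ([:-l, 1:] * q) w
        = (\<Sum>i\<le>N. (- l * coeff q i) *s ((*v) A ^^ i) w)
          + (\<Sum>i\<le>N. coeff (pCons 0 q) i *s ((*v) A ^^ i) w)"
    unfolding poly_apply_upto[OF deg] by (simp add: vector_sadd_rdistrib sum.distrib[symmetric])
  also have "(\<Sum>i\<le>N. (- l * coeff q i) *s ((*v) A ^^ i) w) = - l *s poly_apply A q w"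
    using poly_apply_upto[of q N A w] unfolding N_def by (simp add: smult_sum vector_smult_assoc)
  also have "(\<Sum>i\<le>N. coeff (pCons 0 q) i *s ((*v) A ^^ i) w) = A *v poly_apply A q w"
    unfolding N_def sum.atMost_Suc_shift poly_apply_def
    by (simp add: matrix_vector_sum matrix_vector_smult)
  finally show ?thesis by (simp add: vector_smult_lneg)
qed

lemma poly_apply_in_invariant:
  assumes "complex_subspace W" "invariant A W" "w \<in> W"
  shows "poly_apply A p w \<in> W"
proof -
  have "((*v) A ^^ i) w \<in> W" for i
    using assms(2,3) unfolding invariant_def by (induct i) auto
  then show ?thesis
    using assms(1) unfolding poly_apply_def complex_subspace_def by (intro subspace_sum) auto
qed

text \<open>Any \<open>DIM('a) + 1\<close> vectors of a Euclidean space are linearly dependent.\<close>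
lemma linear_dependence_DIM_Suc:
  fixes f :: "nat \<Rightarrow> 'a::euclidean_space"
  shows "\<exists>c. (\<exists>i\<le>DIM('a). c i \<noteq> 0) \<and> (\<Sum>i\<le>DIM('a). c i *\<^sub>R f i) = 0"
proof (cases "inj_on f {..DIM('a)}")
  case True
  let ?X = "f ` {..DIM('a)}"
  have "card ?X = Suc DIM('a)" using True by (simp add: card_image)
  then have "dependent ?X" using independent_bound[of ?X] by auto
  then obtain u where u: "\<exists>v\<in>?X. u v \<noteq> 0" "(\<Sum>v\<in>?X. u v *\<^sub>R v) = 0"
    using dependent_finite[of ?X] by auto
  have "(\<Sum>i\<le>DIM('a). u (f i) *\<^sub>R f i) = 0"
    using u(2) sum.reindex[OF True, of "\<lambda>v. u v *\<^sub>R v"] by simp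
  moreover have "\<exists>i\<le>DIM('a). u (f i) \<noteq> 0" using u(1) by auto
  ultimately show ?thesis by (intro exI[of _ "u \<circ> f"]) auto
next
  case False
  then obtain i j where ij: "i \<le> DIM('a)" "j \<le> DIM('a)" "i \<noteq> j" "f i = f j"
    unfolding inj_on_def by auto
  define c where "c k = (if k = i then 1 else if k = j then -1 else (0::real))" for k
  have "c k *\<^sub>R f k = (if k = i then f i else 0) - (if k = j then f j else 0)" for k
    using ij(3) unfolding c_def by auto
  then have "(\<Sum>k\<le>DIM('a). c k *\<^sub>R f k) = f i - f j"
    using ij by (simp add: sum_subtractf)
  moreover have "c i \<noteq> 0" unfolding c_def by simp
  ultimately show ?thesis using ij by (intro exI[of _ c]) auto
qed

text \<open>Every vector is annihilated by some nonzero polynomial in \<open>A\<close> (dependence of the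
  Krylov vectors \<open>A\<^sup>i w\<close>).\<close>
lemma annihilating_poly: "\<exists>p. p \<noteq> 0 \<and> poly_apply A p w = 0"
proof -
  define D where "D = DIM(complex^'a::finite)"
  obtain c where c: "\<exists>i\<le>D. c i \<noteq> 0" "(\<Sum>i\<le>D. c i *\<^sub>R ((*v) A ^^ i) (w::complex^'a)) = 0"
    using linear_dependence_DIM_Suc[of "\<lambda>i. ((*v) A ^^ i) w"] unfolding D_def by blast
  define p where "p = (\<Sum>i\<le>D. monom (complex_of_real (c i)) i)"
  have cp: "coeff p k = (if k \<le> D then complex_of_real (c k) else 0)" for k
    unfolding p_def coeff_sum by (simp add: sum.delta)
  obtain i where "i \<le> D" "c i \<noteq> 0" using c(1) by blast
  then have "coeff p i \<noteq> 0" by (simp add: cp)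
  then have "p \<noteq> 0" by auto
  moreover have deg: "degree p \<le> D" by (rule degree_le) (simp add: cp)
  then have "poly_apply A p w = 0"
    unfolding poly_apply_upto[OF deg] using c(2) by (simp add: cp scaleR_smult)
  ultimately show ?thesis by blast
qed

text \<open>A nonzero invariant complex subspace contains an eigenvector (fundamental theorem of
  algebra applied to an annihilating polynomial).\<close>
lemma invariant_subspace_eigenvector:
  assumes W: "complex_subspace W" "invariant A W" and w: "w \<in> W" "w \<noteq> 0"
  shows "\<exists>l u. u \<in> W \<and> u \<noteq> 0 \<and> A *v u = l *s u"
proof -
  obtain p where "p \<noteq> 0" "poly_apply A p w = 0" using annihilating_poly by blast
  then show ?thesis
  proof (induct "degree p" arbitrary: p rule: less_induct)
    case (less p)
    show ?case
    proof (cases "degree p = 0")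
      case True
      then obtain a where "p = [:a:]" by (metis degree_eq_zeroE)
      then show ?thesis using less.prems w(2) by (simp add: poly_apply_def)
    next
      case False
      then obtain l where "poly p l = 0"
        using fundamental_theorem_of_algebra[of p] constant_degree[of p] by auto
      then obtain q where pq: "p = [:-l, 1:] * q" using poly_eq_0_iff_dvd by (metis dvdE)
      have "q \<noteq> 0" using less.prems(1) pq by auto
      then have "degree p = Suc (degree q)" unfolding pq by (subst degree_mult_eq) auto
      then have "degree q < degree p" by simp
      show ?thesis
      proof (cases "poly_apply A q w = 0")
        case True
        then show ?thesis using less.hyps \<open>degree q < degree p\<close> \<open>q \<noteq> 0\<close> by blast
      next
        case False
        have "A *v poly_apply A q w = l *s poly_apply A q w"
          using less.prems(2) unfolding pq poly_apply_linear_factor by simp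
        then show ?thesis using False poly_apply_in_invariant[OF W w(1)] by blast
      qed
    qed
  qed
qed

section \<open>Support and kernel of a positive operator\<close>

definition ker_op :: "'n::finite qop \<Rightarrow> (complex^'n) set" where
  "ker_op A = {v. A *v v = 0}"

text \<open>Eigenvectors with nonzero eigenvalue (together with \<open>0\<close>); their span is the support.\<close>
definition eigvecs :: "'n::finite qop \<Rightarrow> (complex^'n) set" where
  "eigvecs A = {v. \<exists>c. c \<noteq> 0 \<and> A *v v = c *s v}"

lemma supp_eigvecs: "supp A = span (eigvecs A)"
  unfolding supp_def eigvecs_def ..

lemma subspace_ker_op: "subspace (ker_op A)"
  unfolding ker_op_def by (rule linear_subspace_kernel) simp

lemma complex_subspace_ker_op: "complex_subspace (ker_op A)"
  unfolding complex_subspace_def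
  by (simp add: subspace_ker_op) (simp add: ker_op_def matrix_vector_smult)

lemma invariant_ker_op: "invariant A (ker_op A)"
  unfolding invariant_def ker_op_def by simp

lemma complex_subspace_supp: "complex_subspace (supp A)"
  unfolding supp_eigvecs
  by (rule complex_subspace_span)
     (auto simp: eigvecs_def matrix_vector_smult vector_smult_assoc mult.commute)

lemma invariant_supp: "invariant A (supp A)"
proof -
  have "(*v) A ` eigvecs A \<subseteq> supp A"
    using complex_subspace_supp[of A] span_base[of _ "eigvecs A"]
    unfolding eigvecs_def supp_eigvecs complex_subspace_def by fastforce
  then have "span ((*v) A ` eigvecs A) \<subseteq> supp A"
    by (rule span_minimal) (simp add: supp_def)
  then show ?thesis
    unfolding invariant_def supp_eigvecs span_linear_image[OF matrix_vector_mul_linear] by blast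
qed

text \<open>Eigenvectors with nonzero eigenvalue are orthogonal to the kernel.\<close>
lemma supp_subset_perp_ker_op:
  assumes "psd A"
  shows "supp A \<subseteq> (ker_op A)\<^sup>\<bottom>"
  unfolding supp_eigvecs
proof (rule span_minimal[OF _ subspace_orthogonal_comp])
  show "eigvecs A \<subseteq> (ker_op A)\<^sup>\<bottom>"
  proof
    fix v assume "v \<in> eigvecs A"
    then obtain c where c: "c \<noteq> 0" "A *v v = c *s v" unfolding eigvecs_def by blast
    have "ip k v = 0" if "k \<in> ker_op A" for k
      using psd_self_adjoint[OF assms, of k v] that c unfolding ker_op_def
      by (simp add: ip_smult_right)
    then show "v \<in> (ker_op A)\<^sup>\<bottom>"
      unfolding orthogonal_comp_def orthogonal_def by (simp add: inner_ip)
  qed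
qed

text \<open>Conversely, a vector orthogonal to the support lies in the kernel: otherwise the nonzero
  invariant subspace \<open>(supp A)\<^sup>\<bottom> \<inter> (ker_op A)\<^sup>\<bottom>\<close> would contain an eigenvector with nonzero
  eigenvalue, i.e.\ a vector of the support.\<close>
lemma perp_supp_subset_ker_op:
  assumes A: "psd A"
  shows "(supp A)\<^sup>\<bottom> \<subseteq> ker_op A"
proof
  fix z assume z: "z \<in> (supp A)\<^sup>\<bottom>"
  show "z \<in> ker_op A"
  proof (rule ccontr)
    assume "z \<notin> ker_op A"
    let ?W = "(supp A)\<^sup>\<bottom> \<inter> (ker_op A)\<^sup>\<bottom>"
    have inv_supp: "invariant A ((supp A)\<^sup>\<bottom>)"
      by (rule invariant_perp[OF A complex_subspace_supp invariant_supp])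
    have inv_ker: "invariant A ((ker_op A)\<^sup>\<bottom>)"
      by (rule invariant_perp[OF A complex_subspace_ker_op invariant_ker_op])
    have "complex_subspace ?W"
      using complex_subspace_perp[OF complex_subspace_supp]
        complex_subspace_perp[OF complex_subspace_ker_op]
      by (rule complex_subspace_Int)
    moreover have "invariant A ?W" using inv_supp inv_ker unfolding invariant_def by blast
    ultimately have W: "complex_subspace ?W" "invariant A ?W" by blast+
    have "A *v z \<in> (ker_op A)\<^sup>\<bottom>"
      using psd_self_adjoint[OF A]
      unfolding orthogonal_comp_def orthogonal_def ker_op_def by (simp add: inner_ip)
    moreover have "A *v z \<in> (supp A)\<^sup>\<bottom>" using inv_supp z unfolding invariant_def by blast
    moreover have "A *v z \<noteq> 0" using \<open>z \<notin> ker_op A\<close> unfolding ker_op_def by simp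
    ultimately obtain l u where u: "u \<in> ?W" "u \<noteq> 0" "A *v u = l *s u"
      using invariant_subspace_eigenvector[OF W] by blast
    have "u \<notin> ker_op A"
      using u(1,2) orthogonal_Int_0[OF subspace_ker_op, of A] by blast
    then have "l \<noteq> 0" using u(3) unfolding ker_op_def by auto
    then have "u \<in> supp A" using u(3) unfolding supp_eigvecs eigvecs_def by (auto intro: span_base)
    moreover have "subspace (supp A)" unfolding supp_def by simp
    ultimately show False using u(1,2) orthogonal_Int_0 by blast
  qed
qed

theorem supp_eq_perp_ker_op:
  assumes "psd A"
  shows "supp A = (ker_op A)\<^sup>\<bottom>"
proof
  have "(ker_op A)\<^sup>\<bottom> \<subseteq> (supp A)\<^sup>\<bottom>\<^sup>\<bottom>"
    by (rule orthogonal_comp_anti_mono[OF perp_supp_subset_ker_op[OF assms]])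
  then show "(ker_op A)\<^sup>\<bottom> \<subseteq> supp A"
    by (simp add: orthogonal_comp_self supp_def)
qed (rule supp_subset_perp_ker_op[OF assms])

lemma ker_op_eq_perp_supp: "psd A \<Longrightarrow> ker_op A = (supp A)\<^sup>\<bottom>"
  using supp_eq_perp_ker_op orthogonal_comp_self[OF subspace_ker_op] by metis

lemma supp_subset_iff_ker_op:
  "psd A \<Longrightarrow> psd B \<Longrightarrow> supp A \<subseteq> supp B \<longleftrightarrow> ker_op B \<subseteq> ker_op A"
  by (metis ker_op_eq_perp_supp orthogonal_comp_anti_mono supp_eq_perp_ker_op)

section \<open>Supports of sums of positive operators\<close>

lemma ker_op_add:
  assumes "psd A" "psd B"
  shows "ker_op (A + B) = ker_op A \<inter> ker_op B"
proof
  show "ker_op A \<inter> ker_op B \<subseteq> ker_op (A + B)"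
    unfolding ker_op_def by (auto simp: matrix_vector_mult_add_rdistrib)
  show "ker_op (A + B) \<subseteq> ker_op A \<inter> ker_op B"
  proof
    fix v assume "v \<in> ker_op (A + B)"
    then have "sesq v (A + B) v = 0" unfolding ker_op_def by (simp add: sesq_ip)
    then have "sesq v A v + sesq v B v = 0" by (simp add: sesq_add_op)
    then have "Re (sesq v A v) + Re (sesq v B v) = 0" by (metis plus_complex.sel(1) zero_complex.sel(1))
    with psd_quad[OF assms(1), of v] psd_quad[OF assms(2), of v]
    have "sesq v A v = 0" "sesq v B v = 0" by (metis add_nonneg_eq_0_iff of_real_0)+
    then show "v \<in> ker_op A \<inter> ker_op B"
      using psd_quad_zero_imp_kernel assms unfolding ker_op_def by blast
  qed
qed

lemma ker_op_sum:
  assumes "finite I" "\<And>i. i \<in> I \<Longrightarrow> psd (X i)"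
  shows "ker_op (\<Sum>i\<in>I. X i) = (\<Inter>i\<in>I. ker_op (X i))"
  using assms
proof (induct I rule: finite_induct)
  case (insert a I)
  then show ?case by (simp add: ker_op_add psd_sum)
qed (simp add: ker_op_def)

lemma perp_span: "(span S)\<^sup>\<bottom> = (S::'a::euclidean_space set)\<^sup>\<bottom>"
proof
  show "(span S)\<^sup>\<bottom> \<subseteq> S\<^sup>\<bottom>" by (rule orthogonal_comp_anti_mono[OF span_superset])
  have "span S \<subseteq> S\<^sup>\<bottom>\<^sup>\<bottom>"
    by (rule span_minimal[OF orthogonal_comp_subset subspace_orthogonal_comp])
  then show "S\<^sup>\<bottom> \<subseteq> (span S)\<^sup>\<bottom>"
    using orthogonal_comp_anti_mono orthogonal_comp_subset by blast
qed

text \<open>Spanning commutes with taking the span of each part of a union.\<close>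
lemma span_UN_span: "span (\<Union>i\<in>I. span (X i)) = span (\<Union>i\<in>I. X i)"
proof
  show "span (\<Union>i\<in>I. span (X i)) \<subseteq> span (\<Union>i\<in>I. X i)"
    by (intro span_minimal) (auto intro: span_mono[THEN subsetD])
  show "span (\<Union>i\<in>I. X i) \<subseteq> span (\<Union>i\<in>I. span (X i))"
    by (intro span_mono) (auto intro: span_base)
qed

lemma perp_UN: "(\<Union>i\<in>I. S i)\<^sup>\<bottom> = (\<Inter>i\<in>I. (S i)\<^sup>\<bottom>)"
  unfolding orthogonal_comp_def by blast

text \<open>The support of a finite sum of positive operators is spanned by the supports of the
  summands.\<close>
theorem supp_sum:
  assumes "finite I" "\<And>i. i \<in> I \<Longrightarrow> psd (X i)"
  shows "supp (\<Sum>i\<in>I. X i) = span (\<Union>i\<in>I. supp (X i))"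
proof -
  have "supp (\<Sum>i\<in>I. X i) = (\<Inter>i\<in>I. ker_op (X i))\<^sup>\<bottom>"
    by (simp add: supp_eq_perp_ker_op ker_op_sum assms psd_sum)
  also have "(\<Inter>i\<in>I. ker_op (X i)) = (span (\<Union>i\<in>I. supp (X i)))\<^sup>\<bottom>"
    by (simp add: perp_span perp_UN ker_op_eq_perp_supp assms)
  finally show ?thesis by (simp add: orthogonal_comp_self)
qed

section \<open>Comparing positive operators with nested kernels\<close>

text \<open>A continuous real function that is homogeneous of degree two attains, on any nonzero
  subspace, the minimum of \<open>q w / \<parallel>w\<parallel>\<^sup>2\<close> (on the compact unit sphere of the subspace).\<close>
lemma homogeneous_quadratic_min:
  fixes q :: "'a::euclidean_space \<Rightarrow> real"
  assumes U: "subspace U" "U \<noteq> {0}" and q: "continuous_on UNIV q" "\<And>r w. q (r *\<^sub>R w) = r\<^sup>2 * q w"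
  shows "\<exists>u\<in>U. norm u = 1 \<and> (\<forall>w\<in>U. q u * (norm w)\<^sup>2 \<le> q w)"
proof -
  let ?P = "U \<inter> sphere 0 1"
  have unit: "(1 / norm w) *\<^sub>R w \<in> ?P" if "w \<in> U" "w \<noteq> 0" for w
    using that U(1) by (simp add: subspace_scale)
  obtain w where "w \<in> U" "w \<noteq> 0" using U subspace_0 by blast
  then have "?P \<noteq> {}" using unit by blast
  moreover have "compact ?P"
    by (rule closed_Int_compact[OF closed_subspace[OF U(1)] compact_sphere])
  moreover have "continuous_on ?P q" using q(1) by (rule continuous_on_subset) simp
  ultimately obtain u where u: "u \<in> ?P" "\<forall>y\<in>?P. q u \<le> q y"
    using continuous_attains_inf by blast
  have "q u * (norm w)\<^sup>2 \<le> q w" if "w \<in> U" for w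
  proof (cases "w = 0")
    case True
    then show ?thesis using q(2)[of 0 w] by simp
  next
    case False
    have "q u \<le> q ((1 / norm w) *\<^sub>R w)" using u(2) unit[OF that False] by blast
    then have "(norm w)\<^sup>2 * q u \<le> (norm w)\<^sup>2 * q ((1 / norm w) *\<^sub>R w)"
      by (rule mult_left_mono) simp
    also have "\<dots> = q w" using q(2)[of "norm w" "(1 / norm w) *\<^sub>R w"] False by simp
    finally show ?thesis by (simp add: mult.commute)
  qed
  then show ?thesis using u(1) by auto
qed

lemma continuous_quad_form: "continuous_on UNIV (\<lambda>w. Re (sesq w A w))"
  unfolding sesq_def by (intro continuous_intros)

lemma quad_form_scaleR: "Re (sesq (r *\<^sub>R w) A (r *\<^sub>R w)) = r\<^sup>2 * Re (sesq w A w)"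
  by (simp add: scaleR_smult sesq_smult_left sesq_smult_right power2_eq_square)

text \<open>Vectors of the kernel do not contribute to the quadratic form.\<close>
lemma quad_form_add_kernel:
  assumes "psd A" "y \<in> ker_op A"
  shows "sesq (y + z) A (y + z) = sesq z A z"
proof -
  have "sesq z A y = 0" "sesq y A y = 0" using assms(2) by (simp_all add: sesq_ip ker_op_def)
  moreover have "sesq y A z = 0" using psd_hermitian[OF assms(1), of z y] calculation by simp
  ultimately show ?thesis by (simp add: sesq_add_left sesq_add_right)
qed

text \<open>Every quadratic form is bounded above by a multiple of \<open>\<parallel>w\<parallel>\<^sup>2\<close>.\<close>
lemma quad_form_upper_bound: "\<exists>M. \<forall>w. Re (sesq w A w) \<le> M * (norm w)\<^sup>2"
proof -
  obtain u where "\<forall>w. - Re (sesq u A u) * (norm w)\<^sup>2 \<le> - Re (sesq w A w)"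
    using homogeneous_quadratic_min[OF subspace_UNIV UNIV_not_singleton
        continuous_on_minus[OF continuous_quad_form], of A] quad_form_scaleR by auto
  then show ?thesis by (intro exI[of _ "Re (sesq u A u)"]) simp
qed

text \<open>A positive operator is coercive on the orthogonal complement of its kernel.\<close>
lemma psd_coercive_perp_kernel:
  assumes Y: "psd Y"
  shows "\<exists>m>0. \<forall>w\<in>(ker_op Y)\<^sup>\<bottom>. m * (norm w)\<^sup>2 \<le> Re (sesq w Y w)"
proof (cases "(ker_op Y)\<^sup>\<bottom> = {0}")
  case True
  then show ?thesis by (intro exI[of _ 1]) (simp add: sesq_ip)
next
  case False
  have pos: "0 < Re (sesq w Y w)" if "w \<in> (ker_op Y)\<^sup>\<bottom>" "w \<noteq> 0" for w
  proof -
    have "w \<notin> ker_op Y" using that orthogonal_Int_0[OF subspace_ker_op] by blast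
    then have "sesq w Y w \<noteq> 0" using psd_quad_zero_imp_kernel[OF Y] unfolding ker_op_def by blast
    then have "Re (sesq w Y w) \<noteq> 0" using psd_quad[OF Y, of w] by force
    then show ?thesis using psd_quad[OF Y, of w] by linarith
  qed
  obtain u where u: "u \<in> (ker_op Y)\<^sup>\<bottom>" "norm u = 1"
    "\<forall>w\<in>(ker_op Y)\<^sup>\<bottom>. Re (sesq u Y u) * (norm w)\<^sup>2 \<le> Re (sesq w Y w)"
    using homogeneous_quadratic_min[OF subspace_orthogonal_comp False continuous_quad_form
        quad_form_scaleR] by blast
  have "0 < Re (sesq u Y u)" using u(1,2) by (intro pos) auto
  then show ?thesis using u(3) by blast
qed

text \<open>Positive operators with nested kernels are comparable: \<open>X \<le> c Y\<close> for some \<open>c\<close>.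
  Split \<open>v = y + z\<close> with \<open>y\<close> in the kernel of \<open>Y\<close> (hence of \<open>X\<close>) and \<open>z\<close> orthogonal to
  it; on \<open>z\<close> the form of \<open>X\<close> is bounded above and that of \<open>Y\<close> below by multiples of
  \<open>\<parallel>z\<parallel>\<^sup>2\<close>.\<close>
lemma psd_dominated:
  assumes X: "psd X" and Y: "psd Y" and K: "ker_op Y \<subseteq> ker_op X"
  shows "\<exists>c. psd (smul_op (of_real c) Y - X)"
proof -
  let ?f = "\<lambda>w. Re (sesq w Y w)" and ?g = "\<lambda>w. Re (sesq w X w)"
  obtain m where m: "0 < m" "\<forall>w\<in>(ker_op Y)\<^sup>\<bottom>. m * (norm w)\<^sup>2 \<le> ?f w"
    using psd_coercive_perp_kernel[OF Y] by blast
  obtain M where M: "\<forall>w. ?g w \<le> M * (norm w)\<^sup>2" using quad_form_upper_bound by blast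
  define c where "c = max M 0 / m"
  have "c \<ge> 0" using m(1) unfolding c_def by simp
  have dom: "?g v \<le> c * ?f v" for v
  proof -
    obtain y z where yz: "y \<in> ker_op Y" "z \<in> (ker_op Y)\<^sup>\<bottom>" "v = y + z"
      using subspace_sum_orthogonal_comp[OF subspace_ker_op] set_plus_elim by blast
    have "?g v = ?g z" using quad_form_add_kernel[OF X] yz(1,3) K by auto
    also have "\<dots> \<le> max M 0 * (norm z)\<^sup>2"
      using M by (meson max.cobounded1 mult_right_mono order_trans zero_le_power2)
    also have "\<dots> = c * (m * (norm z)\<^sup>2)" using m(1) unfolding c_def by simp
    also have "\<dots> \<le> c * ?f z" using m(2) yz(2) \<open>c \<ge> 0\<close> by (simp add: mult_left_mono)
    also have "\<dots> = c * ?f v" using quad_form_add_kernel[OF Y yz(1)] yz(3) by simp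
    finally show ?thesis .
  qed
  have "psd (smul_op (of_real c) Y - X)"
    unfolding psd_def
  proof
    fix v
    have "sesq v X v = of_real (?g v)" "sesq v Y v = of_real (?f v)"
      using psd_quad[OF X] psd_quad[OF Y] by blast+
    then have "sesq v (smul_op (of_real c) Y - X) v = of_real (c * ?f v - ?g v)"
      by (simp add: sesq_diff_op sesq_smul_op)
    then show "Im (sesq v (smul_op (of_real c) Y - X) v) = 0 \<and>
               0 \<le> Re (sesq v (smul_op (of_real c) Y - X) v)"
      using dom[of v] by simp
  qed
  then show ?thesis by blast
qed

section \<open>Positive maps preserve inclusion of supports\<close>

text \<open>Linear maps on operators that send positive operators to positive ones.\<close>
definition positive_map :: "('n::finite qop \<Rightarrow> 'n qop) \<Rightarrow> bool" where
  "positive_map \<Phi> \<longleftrightarrow> (\<forall>A B. \<Phi> (A + B) = \<Phi> A + \<Phi> B) \<and>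
     (\<forall>c A. \<Phi> (smul_op c A) = smul_op c (\<Phi> A)) \<and> (\<forall>A. psd A \<longrightarrow> psd (\<Phi> A))"

lemma positive_map_diff: "positive_map \<Phi> \<Longrightarrow> \<Phi> (A - B) = \<Phi> A - \<Phi> B"
  unfolding positive_map_def by (metis add_diff_cancel diff_add_cancel)

text \<open>If \<open>X \<le> c Y\<close> then the kernel of \<open>Y\<close> is contained in that of \<open>X\<close>.\<close>
lemma dominated_ker_op:
  assumes X: "psd X" and Z: "psd (smul_op c Y - X)"
  shows "ker_op Y \<subseteq> ker_op X"
proof
  fix v assume "v \<in> ker_op Y"
  then have "sesq v Y v = 0" by (simp add: sesq_ip ker_op_def)
  then have "sesq v (smul_op c Y - X) v = - sesq v X v" by (simp add: sesq_diff_op sesq_smul_op)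
  then have "Re (sesq v X v) \<le> 0" using psd_quad[OF Z, of v] by simp
  then have "Re (sesq v X v) = 0" using psd_quad[OF X, of v] by simp
  then have "sesq v X v = 0" using psd_quad[OF X, of v] by (metis of_real_0)
  then show "v \<in> ker_op X" using psd_quad_zero_imp_kernel[OF X] unfolding ker_op_def by blast
qed

text \<open>Positive maps preserve inclusion of supports, the key monotonicity property of the
  reachable spaces.\<close>
theorem positive_map_supp_mono:
  assumes \<Phi>: "positive_map \<Phi>" and X: "psd X" and Y: "psd Y" and XY: "supp X \<subseteq> supp Y"
  shows "supp (\<Phi> X) \<subseteq> supp (\<Phi> Y)"
proof -
  have psd\<Phi>: "psd A \<Longrightarrow> psd (\<Phi> A)" for A using \<Phi> unfolding positive_map_def by blast
  obtain c where "psd (smul_op (of_real c) Y - X)"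
    using psd_dominated[OF X Y] XY supp_subset_iff_ker_op[OF X Y] by blast
  then have "psd (smul_op (of_real c) (\<Phi> Y) - \<Phi> X)"
    using psd\<Phi> \<Phi> by (metis positive_map_def positive_map_diff)
  then have "ker_op (\<Phi> Y) \<subseteq> ker_op (\<Phi> X)" by (rule dominated_ker_op[OF psd\<Phi>[OF X]])
  then show ?thesis using supp_subset_iff_ker_op psd\<Phi> X Y by blast
qed

text \<open>Super-operators, conjugations and their sums and powers are positive maps.\<close>

lemma block_psd_1: "block_psd 1 X \<longleftrightarrow> psd (X 0 0)"
  unfolding block_psd_def psd_def
proof (intro iffI allI)
  fix v assume "\<forall>v :: nat \<Rightarrow> complex^'a. Im (\<Sum>i<1. \<Sum>j<1. sesq (v i) (X i j) (v j)) = 0 \<and>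
                  0 \<le> Re (\<Sum>i<1. \<Sum>j<1. sesq (v i) (X i j) (v j))"
  from spec[OF this, of "\<lambda>_. v"]
  show "Im (sesq v (X 0 0) v) = 0 \<and> 0 \<le> Re (sesq v (X 0 0) v)" by simp
qed simp

lemma positive_map_super_operator:
  assumes "super_operator \<Phi>"
  shows "positive_map \<Phi>"
proof -
  have "psd (\<Phi> A)" if "psd A" for A
  proof -
    have "block_psd 1 (\<lambda>i j. A)" using that block_psd_1[of "\<lambda>i j. A"] by simp
    then have "block_psd 1 (\<lambda>i j. \<Phi> A)"
      using assms unfolding super_operator_def completely_positive_def by blast
    then show ?thesis using block_psd_1[of "\<lambda>i j. \<Phi> A"] by simp
  qed
  then show ?thesis
    using assms unfolding super_operator_def clinear_op_def positive_map_def by blast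
qed

lemma matrix_add_rdistrib: "(A + B) ** C = A ** C + B ** (C::'n::finite qop)"
  by (simp add: vec_eq_iff matrix_matrix_mult_def distrib_right sum.distrib)

lemma positive_map_conj:
  fixes M :: "'n::finite qop"
  shows "positive_map (\<lambda>\<rho>. M ** \<rho> ** adj M)"
  unfolding positive_map_def
proof (intro conjI allI impI)
  fix A B :: "'n qop"
  show "M ** (A + B) ** adj M = M ** A ** adj M + M ** B ** adj M"
    by (simp add: matrix_add_ldistrib matrix_add_rdistrib)
next
  fix c and A :: "'n qop"
  show "M ** smul_op c A ** adj M = smul_op c (M ** A ** adj M)"
    by (simp add: vec_eq_iff matrix_matrix_mult_def smul_op_def sum_distrib_left
        sum_distrib_right mult_ac)
next
  fix A :: "'n qop" assume "psd A"
  moreover have "sesq v (M ** A ** adj M) v = sesq (adj M *v v) A (adj M *v v)" for v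
    by (simp add: sesq_ip matrix_vector_mul_assoc[symmetric] ip_adj)
  ultimately show "psd (M ** A ** adj M)" unfolding psd_def by simp
qed

lemma positive_map_comp: "positive_map \<Phi> \<Longrightarrow> positive_map \<Psi> \<Longrightarrow> positive_map (\<lambda>x. \<Phi> (\<Psi> x))"
  unfolding positive_map_def by auto

lemma positive_map_zero: "positive_map \<Phi> \<Longrightarrow> \<Phi> 0 = 0"
  unfolding positive_map_def by (metis add.right_neutral add_left_cancel)

lemma positive_map_sum: "positive_map \<Phi> \<Longrightarrow> \<Phi> (\<Sum>i\<in>I. X i) = (\<Sum>i\<in>I. \<Phi> (X i))"
  by (induct I rule: infinite_finite_induct)
     (simp_all add: positive_map_zero, simp add: positive_map_def)

lemma smul_op_sum: "smul_op c (\<Sum>i\<in>I. X i) = (\<Sum>i\<in>I. smul_op c (X i :: 'n::finite qop))"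
  by (induct I rule: infinite_finite_induct)
     (simp_all add: smul_op_def vec_eq_iff distrib_left)

lemma positive_map_sum_maps:
  "(\<And>k. k \<in> K \<Longrightarrow> positive_map (\<Phi> k)) \<Longrightarrow> positive_map (\<lambda>x. \<Sum>k\<in>K. \<Phi> k x)"
  unfolding positive_map_def by (auto simp: sum.distrib smul_op_sum intro!: psd_sum)

lemma positive_map_funpow: "positive_map \<Phi> \<Longrightarrow> positive_map (\<Phi> ^^ i)"
proof (induct i)
  case 0
  then show ?case by (simp add: positive_map_def)
next
  case (Suc i)
  then show ?case using positive_map_comp[of \<Phi> "\<Phi> ^^ i"] by simp
qed

section \<open>Chains of complex subspaces stabilize within \<open>d\<close> steps\<close>

text \<open>A proper inclusion of complex subspaces raises the real dimension by at least two.\<close>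
lemma complex_subspace_dim_step:
  assumes U: "complex_subspace U" and U': "complex_subspace (U'::(complex^'n::finite) set)"
    and "U \<subseteq> U'" "U \<noteq> U'"
  shows "dim U + 2 \<le> dim U'"
proof -
  obtain v where v: "v \<in> U'" "v \<notin> U" using assms(3,4) by blast
  have spU: "span U = U" using U unfolding complex_subspace_def by (simp add: span_eq_iff)
  have iv: "\<i> *s v \<notin> span (insert v U)"
  proof
    assume "\<i> *s v \<in> span (insert v U)"
    then obtain k where "\<i> *s v - k *\<^sub>R v \<in> U" unfolding span_insert spU by blast
    then have "(\<i> - of_real k) *s v \<in> U" by (simp add: scaleR_smult vector_sub_rdistrib)
    then have "(1 / (\<i> - of_real k)) *s ((\<i> - of_real k) *s v) \<in> U"
      using U unfolding complex_subspace_def by blast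
    moreover have "\<i> - of_real k \<noteq> 0" by (simp add: complex_eq_iff)
    then have "(1 / (\<i> - of_real k)) *s ((\<i> - of_real k) *s v) = v"
      by (simp only: vector_smult_assoc) simp
    ultimately show False using v(2) by simp
  qed
  have "v \<notin> span U" unfolding spU by (rule v(2))
  then have "dim (insert (\<i> *s v) (insert v U)) = dim U + 2"
    using iv by (simp add: dim_insert)
  moreover have "insert (\<i> *s v) (insert v U) \<subseteq> U'"
    using v assms(3) U' unfolding complex_subspace_def by blast
  ultimately show ?thesis by (metis dim_subset)
qed

text \<open>An increasing chain of complex subspaces of \<open>\<complex>\<^sup>d\<close> in which one equality propagates to
  the next step is constant from index \<open>d\<close> on: each strict step raises the real dimension by
  two, and the real dimension is at most \<open>2d\<close>.\<close>
lemma ascending_chain_stable: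
  fixes C :: "nat \<Rightarrow> (complex^'n::finite) set"
  assumes cs: "\<And>n. complex_subspace (C n)" and mono: "\<And>n. C n \<subseteq> C (Suc n)"
    and persist: "\<And>n. C (Suc n) = C n \<Longrightarrow> C (Suc (Suc n)) = C (Suc n)"
  shows "C (CARD('n) + t) = C (CARD('n))"
proof (cases "\<exists>k<CARD('n). C (Suc k) = C k")
  case True
  then obtain k where k: "k < CARD('n)" "C (Suc k) = C k" by blast
  have step: "C (Suc (k + t)) = C (k + t)" for t
    by (induct t) (use k(2) persist in auto)
  have const: "C (k + t) = C k" for t
    by (induct t) (use step in auto)
  have "C (k + (CARD('n) - k + t)) = C (k + (CARD('n) - k))" by (simp only: const)
  then show ?thesis using k(1) by simp
next
  case False
  have "2 * k \<le> dim (C k)" if "k \<le> CARD('n)" for k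
    using that
  proof (induct k)
    case (Suc k)
    then have "k < CARD('n)" by simp
    then have "C k \<noteq> C (Suc k)" using False by metis
    then have "dim (C k) + 2 \<le> dim (C (Suc k))"
      by (intro complex_subspace_dim_step cs mono)
    then show ?case using Suc by simp
  qed simp
  from this[of "CARD('n)"] have "dim (C (CARD('n))) \<ge> DIM(complex^'n)" by simp
  then have full: "C (CARD('n)) = UNIV"
    using cs dim_eq_full dim_subset_UNIV unfolding complex_subspace_def
    by (metis le_antisym span_eq_iff)
  have "C (CARD('n)) \<subseteq> C (CARD('n) + t)" by (rule lift_Suc_mono_le[of C]) (use mono in auto)
  then show ?thesis using full by blast
qed

text \<open>The dual statement for decreasing chains, via orthogonal complements.\<close>
lemma descending_chain_stable:
  fixes C :: "nat \<Rightarrow> (complex^'n::finite) set"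
  assumes cs: "\<And>n. complex_subspace (C n)" and anti: "\<And>n. C (Suc n) \<subseteq> C n"
    and persist: "\<And>n. C (Suc n) = C n \<Longrightarrow> C (Suc (Suc n)) = C (Suc n)"
  shows "C (CARD('n) + t) = C (CARD('n))"
proof -
  have perp_perp: "(C n)\<^sup>\<bottom>\<^sup>\<bottom> = C n" for n
    using cs unfolding complex_subspace_def by (simp add: orthogonal_comp_self)
  have perp_eq: "(C a)\<^sup>\<bottom> = (C b)\<^sup>\<bottom> \<longleftrightarrow> C a = C b" for a b by (metis perp_perp)
  have "(C (CARD('n) + t))\<^sup>\<bottom> = (C (CARD('n)))\<^sup>\<bottom>"
    using ascending_chain_stable[of "\<lambda>n. (C n)\<^sup>\<bottom>"]
    by (simp add: complex_subspace_perp cs orthogonal_comp_anti_mono anti perp_eq persist)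
  then show ?thesis by (simp add: perp_eq)
qed

section \<open>Sequences of subspaces whose inclusions are preserved by shifting\<close>

text \<open>The supports \<open>S i = supp (\<F>\<^sup>i \<rho>\<^sub>0)\<close> form a sequence of complex subspaces with the
  property that an inclusion \<open>S j \<subseteq> span (\<Union>i\<in>I. S i)\<close> survives shifting all indices by
  one. This alone determines the intersection of the tail spans.\<close>
locale shift_monotone =
  fixes S :: "nat \<Rightarrow> (complex^'n::finite) set"
  assumes complex_subspace_S: "\<And>i. complex_subspace (S i)"
    and shift: "\<And>I j. finite I \<Longrightarrow> S j \<subseteq> span (\<Union>i\<in>I. S i) \<Longrightarrow>
                  S (Suc j) \<subseteq> span (\<Union>i\<in>I. S (Suc i))"
begin

text \<open>Spans of the \<open>k\<close> consecutive terms starting at \<open>a\<close>, and of all terms from \<open>a\<close> on.\<close>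
definition window :: "nat \<Rightarrow> nat \<Rightarrow> (complex^'n) set" where
  "window a k = span (\<Union>i\<in>{a..<a+k}. S i)"

definition tail :: "nat \<Rightarrow> (complex^'n) set" where
  "tail a = span (\<Union>i\<in>{a..}. S i)"

lemma complex_subspace_span_UN: "complex_subspace (span (\<Union>i\<in>I. S i))"
  by (rule complex_subspace_span) (use complex_subspace_S in \<open>auto simp: complex_subspace_def\<close>)

lemma window_mono: "k \<le> k' \<Longrightarrow> window a k \<subseteq> window a k'"
  unfolding window_def by (intro span_mono UN_mono) auto

lemma S_subset_window: "a \<le> j \<Longrightarrow> j < a + k \<Longrightarrow> S j \<subseteq> window a k"
  unfolding window_def by (rule order.trans[OF _ span_superset]) auto

text \<open>If the window stops growing, it already contains every later term.\<close>
lemma window_absorbs: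
  assumes "window a (Suc k) \<subseteq> window a k"
  shows "a \<le> j \<Longrightarrow> S j \<subseteq> window a k"
proof (induct j)
  case 0
  then show ?case using S_subset_window[of a 0 "Suc k"] assms by simp
next
  case (Suc j)
  show ?case
  proof (cases "Suc j \<le> a + k")
    case True
    then show ?thesis using S_subset_window[of a "Suc j" "Suc k"] Suc.prems assms by simp
  next
    case False
    then have "S j \<subseteq> span (\<Union>i\<in>{a..<a+k}. S i)" using Suc unfolding window_def by simp
    then have "S (Suc j) \<subseteq> span (\<Union>i\<in>{a..<a+k}. S (Suc i))" by (intro shift) auto
    also have "\<dots> \<subseteq> window a (Suc k)" unfolding window_def by (intro span_mono) force
    finally show ?thesis using assms by blast
  qed
qed

lemma window_persist:
  assumes "window a (Suc k) = window a k"
  shows "window a (Suc (Suc k)) = window a (Suc k)"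
proof -
  have "S i \<subseteq> window a k" if "i \<in> {a..<a + Suc (Suc k)}" for i
    using window_absorbs[OF equalityD1[OF assms]] that by simp
  then have "(\<Union>i\<in>{a..<a + Suc (Suc k)}. S i) \<subseteq> window a k" by blast
  then have "window a (Suc (Suc k)) \<subseteq> window a k"
    unfolding window_def[of a "Suc (Suc k)"] by (rule span_minimal) (simp add: window_def)
  then show ?thesis using assms window_mono[of "Suc k" "Suc (Suc k)" a] by auto
qed

lemma complex_subspace_window: "complex_subspace (window a k)"
  unfolding window_def by (rule complex_subspace_span_UN)

text \<open>Every tail span is already spanned by a window of length \<open>d\<close>.\<close>
lemma tail_eq_window: "tail a = window a (CARD('n))"
proof
  have "window a k \<subseteq> window a (Suc k)" for k by (rule window_mono) simp
  then have stable: "window a (CARD('n) + t) = window a (CARD('n))" for t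
    by (rule ascending_chain_stable[of "window a", OF complex_subspace_window _ window_persist])
  have "S j \<subseteq> window a (CARD('n))" if "a \<le> j" for j
  proof -
    have "S j \<subseteq> window a (CARD('n) + Suc (j - a))" using that by (intro S_subset_window) auto
    then show ?thesis unfolding stable .
  qed
  then show "tail a \<subseteq> window a (CARD('n))"
    unfolding tail_def by (intro span_minimal) (auto simp: window_def)
  show "window a (CARD('n)) \<subseteq> tail a"
    unfolding window_def tail_def by (intro span_mono) auto
qed

lemma S_subset_tail: "a \<le> j \<Longrightarrow> S j \<subseteq> tail a"
  unfolding tail_def by (rule order.trans[OF _ span_superset]) auto

lemma tail_antimono: "a \<le> b \<Longrightarrow> tail b \<subseteq> tail a"
  unfolding tail_def by (intro span_mono UN_mono) auto

lemma complex_subspace_tail: "complex_subspace (tail a)"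
  unfolding tail_def by (rule complex_subspace_span_UN)

text \<open>Once a term lies in the span of its successors, so does the next one.\<close>
lemma tail_persist:
  assumes "tail (Suc n) = tail n"
  shows "tail (Suc (Suc n)) = tail (Suc n)"
proof -
  have "S n \<subseteq> span (\<Union>i\<in>{Suc n..<Suc n + CARD('n)}. S i)"
    using S_subset_tail[of n n] assms tail_eq_window unfolding window_def by simp
  then have "S (Suc n) \<subseteq> span (\<Union>i\<in>{Suc n..<Suc n + CARD('n)}. S (Suc i))" by (intro shift) auto
  also have "\<dots> \<subseteq> tail (Suc (Suc n))" unfolding tail_def by (intro span_mono) force
  finally have "S i \<subseteq> tail (Suc (Suc n))" if "Suc n \<le> i" for i
    using that S_subset_tail[of "Suc (Suc n)" i] by (cases "i = Suc n") auto
  then have "tail (Suc n) \<subseteq> tail (Suc (Suc n))"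
    unfolding tail_def[of "Suc n"] by (intro span_minimal) (auto simp: tail_def)
  then show ?thesis using tail_antimono[of "Suc n" "Suc (Suc n)"] by auto
qed

text \<open>The intersection of all tail spans is the span of the terms \<open>d, \<dots>, 2d - 1\<close>.\<close>
theorem Inter_tail: "(\<Inter>n. tail n) = window (CARD('n)) (CARD('n))"
proof -
  have "tail (Suc n) \<subseteq> tail n" for n by (rule tail_antimono) simp
  then have stable: "tail (CARD('n) + t) = tail (CARD('n))" for t
    by (rule descending_chain_stable[of tail, OF complex_subspace_tail _ tail_persist])
  have "tail (CARD('n)) \<subseteq> tail n" for n
    using tail_antimono stable[of "n - CARD('n)"] by (cases "n \<le> CARD('n)") auto
  then have "(\<Inter>n. tail n) = tail (CARD('n))" by blast
  then show ?thesis by (simp add: tail_eq_window)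
qed

end

section \<open>The reachable spaces of a concurrent quantum program\<close>

context
  fixes m :: nat and E :: "nat \<Rightarrow> 'n::finite qop \<Rightarrow> 'n qop" and M1 :: "'n qop"
  assumes super: "\<And>k. k \<in> {1..m} \<Longrightarrow> super_operator (E k)"
begin

lemma positive_map_Fk: "k \<in> {1..m} \<Longrightarrow> positive_map (Fk E M1 k)"
  using positive_map_comp[OF positive_map_super_operator[OF super] positive_map_conj]
  unfolding Fk_def[abs_def] by blast

lemma positive_map_Fsum: "positive_map (Fsum m E M1)"
  unfolding Fsum_def[abs_def] by (rule positive_map_sum_maps) (rule positive_map_Fk)

text \<open>Strings of length \<open>i\<close> over the alphabet \<open>K = {1..m}\<close>.\<close>
definition strings_len :: "nat \<Rightarrow> nat list set" where
  "strings_len i = {f. set f \<subseteq> {1..m} \<and> length f = i}"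

lemma finite_strings_len: "finite (strings_len i)"
proof -
  have "strings_len i \<subseteq> {f. set f \<subseteq> {1..m} \<and> length f \<le> i}" unfolding strings_len_def by auto
  then show ?thesis using finite_lists_length_le[of "{1..m}" i] finite_subset by blast
qed

lemma strings_len_Suc: "strings_len (Suc i) = (\<lambda>(f, k). f @ [k]) ` (strings_len i \<times> {1..m})"
proof
  show "(\<lambda>(f, k). f @ [k]) ` (strings_len i \<times> {1..m}) \<subseteq> strings_len (Suc i)"
    unfolding strings_len_def by auto
  show "strings_len (Suc i) \<subseteq> (\<lambda>(f, k). f @ [k]) ` (strings_len i \<times> {1..m})"
  proof
    fix g assume g: "g \<in> strings_len (Suc i)"
    then have "g \<noteq> []" unfolding strings_len_def by auto
    then have "g = butlast g @ [last g]" by simp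
    moreover have "butlast g \<in> strings_len i" "last g \<in> {1..m}"
      using g \<open>g \<noteq> []\<close> unfolding strings_len_def
      by (auto dest: in_set_butlastD simp: last_in_set subset_iff)
    ultimately show "g \<in> (\<lambda>(f, k). f @ [k]) ` (strings_len i \<times> {1..m})" by force
  qed
qed

lemma psd_Fstr: "set f \<subseteq> {1..m} \<Longrightarrow> psd \<rho> \<Longrightarrow> psd (Fstr E M1 f \<rho>)"
proof (induct f arbitrary: \<rho>)
  case (Cons k f)
  then have "psd (Fk E M1 k \<rho>)" using positive_map_Fk[of k] unfolding positive_map_def by auto
  then show ?case using Cons by (simp add: Fstr_def)
qed (simp add: Fstr_def)

text \<open>\<open>\<F>\<^sup>i\<close> is the sum of the \<open>\<F>\<^sub>f\<close> over all strings \<open>f\<close> of length \<open>i\<close>.\<close>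
lemma Fsum_funpow: "(Fsum m E M1 ^^ i) \<rho> = (\<Sum>f\<in>strings_len i. Fstr E M1 f \<rho>)"
proof (induct i)
  case 0
  have "strings_len 0 = {[]}" unfolding strings_len_def by auto
  then show ?case by (simp add: Fstr_def)
next
  case (Suc i)
  have "(Fsum m E M1 ^^ Suc i) \<rho> = Fsum m E M1 (\<Sum>f\<in>strings_len i. Fstr E M1 f \<rho>)"
    using Suc by simp
  also have "\<dots> = (\<Sum>k\<in>{1..m}. Fk E M1 k (\<Sum>f\<in>strings_len i. Fstr E M1 f \<rho>))"
    by (rule Fsum_def)
  also have "\<dots> = (\<Sum>k\<in>{1..m}. \<Sum>f\<in>strings_len i. Fstr E M1 (f @ [k]) \<rho>)"
    by (intro sum.cong refl) (simp add: positive_map_sum[OF positive_map_Fk] Fstr_def)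
  also have "\<dots> = (\<Sum>(f, k)\<in>strings_len i \<times> {1..m}. Fstr E M1 (f @ [k]) \<rho>)"
    by (subst sum.swap) (rule sum.cartesian_product)
  also have "\<dots> = (\<Sum>g\<in>strings_len (Suc i). Fstr E M1 g \<rho>)"
    unfolding strings_len_Suc by (subst sum.reindex) (auto simp: inj_on_def case_prod_beta)
  finally show ?case .
qed

text \<open>Hence the support of \<open>\<F>\<^sup>i \<rho>\<close> is spanned by the supports reachable along strings of
  length \<open>i\<close>.\<close>
lemma supp_Fsum_funpow:
  assumes "psd \<rho>"
  shows "supp ((Fsum m E M1 ^^ i) \<rho>) = span (\<Union>f\<in>strings_len i. supp (Fstr E M1 f \<rho>))"
  unfolding Fsum_funpow using assms
  by (intro supp_sum finite_strings_len psd_Fstr) (auto simp: strings_len_def)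

lemma psd_iterates: "psd \<rho> \<Longrightarrow> psd ((Fsum m E M1 ^^ i) \<rho>)"
  using positive_map_funpow[OF positive_map_Fsum] unfolding positive_map_def by blast

text \<open>The supports of the iterates \<open>\<F>\<^sup>i \<rho>\<close> form a shift-monotone sequence.\<close>
lemma shift_monotone_supp_iterates:
  assumes "psd \<rho>"
  shows "shift_monotone (\<lambda>i. supp ((Fsum m E M1 ^^ i) \<rho>))"
proof
  let ?F = "Fsum m E M1"
  let ?\<rho> = "\<lambda>i. (?F ^^ i) \<rho>"
  have psd_iter: "psd (?\<rho> i)" for i by (rule psd_iterates[OF assms])
  have supp_window: "supp (\<Sum>i\<in>I. ?\<rho> i) = span (\<Union>i\<in>I. supp (?\<rho> i))" if "finite I" for I
    using that psd_iter by (rule supp_sum)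
  fix I j assume I: "finite I" and "supp (?\<rho> j) \<subseteq> span (\<Union>i\<in>I. supp (?\<rho> i))"
  then have "supp (?\<rho> j) \<subseteq> supp (\<Sum>i\<in>I. ?\<rho> i)" by (simp only: supp_window)
  then have "supp (?F (?\<rho> j)) \<subseteq> supp (?F (\<Sum>i\<in>I. ?\<rho> i))"
    by (rule positive_map_supp_mono[OF positive_map_Fsum psd_iter psd_sum[OF psd_iter]])
  also have "?F (\<Sum>i\<in>I. ?\<rho> i) = (\<Sum>i\<in>I. ?\<rho> (Suc i))"
    by (simp add: positive_map_sum[OF positive_map_Fsum])
  also have "supp \<dots> = span (\<Union>i\<in>I. supp (?\<rho> (Suc i)))"
    using I psd_iter by (rule supp_sum)
  finally show "supp (?\<rho> (Suc j)) \<subseteq> span (\<Union>i\<in>I. supp (?\<rho> (Suc i)))" by simp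
qed (rule complex_subspace_supp)

text \<open>The span of the supports reached along strings of length at least \<open>n\<close> is the span of
  the supports of the iterates \<open>\<F>\<^sup>i \<rho>\<close>, \<open>i \<ge> n\<close>.\<close>
lemma span_reachable_eq_span_iterates:
  assumes "psd \<rho>"
  shows "span (\<Union>{supp (Fstr E M1 f \<rho>) | f. set f \<subseteq> {1..m} \<and> length f \<ge> n})
         = span (\<Union>i\<in>{n..}. supp ((Fsum m E M1 ^^ i) \<rho>))"
proof -
  have "\<Union>{supp (Fstr E M1 f \<rho>) | f. set f \<subseteq> {1..m} \<and> length f \<ge> n}
        = (\<Union>i\<in>{n..}. \<Union>f\<in>strings_len i. supp (Fstr E M1 f \<rho>))"
    unfolding strings_len_def by auto
  then show ?thesis
    by (simp add: supp_Fsum_funpow[OF assms] span_UN_span)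
qed

end

section \<open>Main theorem\<close>

theorem mainTheorem3:
  fixes m :: nat and E :: "nat \<Rightarrow> 'n::finite qop \<Rightarrow> 'n qop"
    and M0 M1 \<rho>0 :: "'n qop"
  assumes "concurrent_program m E M0 M1"
    and "density_op \<rho>0"
  shows "H_URR m E M1 \<rho>0 =
         supp (\<Sum>i\<in>{CARD('n)..2 * CARD('n) - 1}. (Fsum m E M1 ^^ i) \<rho>0)"
proof -
  let ?\<rho> = "\<lambda>i. (Fsum m E M1 ^^ i) \<rho>0"
  have super: "\<And>k. k \<in> {1..m} \<Longrightarrow> super_operator (E k)"
    using assms(1) unfolding concurrent_program_def by blast
  have \<rho>0: "psd \<rho>0" using assms(2) unfolding density_op_def by blast
  interpret shift_monotone "\<lambda>i. supp (?\<rho> i)"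
    by (rule shift_monotone_supp_iterates[OF super \<rho>0])
  have reach: "span (\<Union>{supp (Fstr E M1 f \<rho>0) | f. set f \<subseteq> {1..m} \<and> length f \<ge> n}) = tail n"
    for n unfolding tail_def by (rule span_reachable_eq_span_iterates[OF super \<rho>0])
  have "CARD('n) + CARD('n) = Suc (2 * CARD('n) - 1)"
    using zero_less_card_finite[where 'a='n] by arith
  then have indices: "{CARD('n)..<CARD('n) + CARD('n)} = {CARD('n)..2 * CARD('n) - 1}"
    by (simp only: atLeastLessThanSuc_atLeastAtMost)
  have "H_URR m E M1 \<rho>0 = (\<Inter>n. tail n)" unfolding H_URR_def reach ..
  also have "\<dots> = window (CARD('n)) (CARD('n))" by (rule Inter_tail)
  also have "\<dots> = span (\<Union>i\<in>{CARD('n)..2 * CARD('n) - 1}. supp (?\<rho> i))"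
    unfolding window_def indices ..
  also have "\<dots> = supp (\<Sum>i\<in>{CARD('n)..2 * CARD('n) - 1}. ?\<rho> i)"
    using psd_iterates[OF super \<rho>0] by (intro supp_sum[symmetric]) auto
  finally show ?thesis .
qed

end
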